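(* Let $Y$ be a real random variable whose moment generating function $E[e^{tY}]$ exists for $|t|<r$, for some $r>0$. Then for any integer $n\ge 0$ and all real $x,y$, $$B_{n}^{(L,Y)}(x+y)=\sum_{k=0}^{n}\binom{n}{k}B_{k}^{(L,Y)}(x)B_{n-k}^{(L,Y)}(y).$$
   Context: The probabilistic Lah numbers $L_Y(n,k)$ ($n\ge k\ge 0$) associated with $Y$ are defined by the power series expansion about $t=0$ $$\frac{1}{k!}\left(E\left[\left(\frac{1}{1-t}\right)^{Y}\right]-1\right)^{k}=\sum_{n=k}^{\infty}L_{Y}(n,k)\frac{t^{n}}{n!},\quad k\ge 0.$$ The probabilistic Lah-Bell polynomials associated with $Y$ are $B_{n}^{(L,Y)}(x)=\sum_{k=0}^{n}L_{Y}(n,k)x^{k}$, $n\ge 0$. *)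

theory Defs
  imports "HOL-Probability.Probability"
begin

text \<open>
  The probabilistic Lah numbers are the coefficients of the expansion
  \<open>(1/k!) (E[(1/(1-t))^Y] - 1)^k = \<Sum>n\<ge>k. L_Y(n,k) t^n/n!\<close>, valid for all real \<open>t\<close> near \<open>0\<close>.
  The expansion determines the values at \<open>n \<ge> k\<close> only; the values at \<open>n < k\<close> are \<open>0\<close> by
  convention. When no such expansion exists the number is unspecified.
\<close>

definition is_prob_lah_coeffs ::
    "'a measure \<Rightarrow> ('a \<Rightarrow> real) \<Rightarrow> nat \<Rightarrow> (nat \<Rightarrow> real) \<Rightarrow> bool" where
  "is_prob_lah_coeffs M Y k a \<longleftrightarrow>
     (\<forall>n<k. a n = 0) \<and>
     (\<forall>\<^sub>F t in nhds (0::real).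
        (\<lambda>j. a (k + j) * t ^ (k + j) / fact (k + j)) sums
        (1 / fact k * (integral\<^sup>L M (\<lambda>\<omega>. (1 / (1 - t)) powr Y \<omega>) - 1) ^ k))"

definition prob_lah :: "'a measure \<Rightarrow> ('a \<Rightarrow> real) \<Rightarrow> nat \<Rightarrow> nat \<Rightarrow> real" where
  "prob_lah M Y n k = (THE a. is_prob_lah_coeffs M Y k a) n"

definition prob_lah_bell :: "'a measure \<Rightarrow> ('a \<Rightarrow> real) \<Rightarrow> nat \<Rightarrow> real \<Rightarrow> real" where
  "prob_lah_bell M Y n x = (\<Sum>k=0..n. prob_lah M Y n k * x ^ k)"

end

theory Submission imports Defs begin

text \<open>
  Expanding \<open>(1 - t)\<^sup>-\<^sup>Y = \<Sum>n. pochhammer Y n / n! t\<^sup>n\<close> and integrating termwise, dominated by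
  \<open>(1 - \<bar>t\<bar>)\<^bsup>-\<bar>Y\<bar>\<^esup>\<close>, shows that \<open>E[(1 - t)\<^sup>-\<^sup>Y] - 1\<close> has a power series \<open>g\<close> without constant
  term near \<open>0\<close>. Hence \<open>L\<^sub>Y(n,k) = n!/k! [t\<^sup>n] g\<^sup>k\<close>, so \<open>B\<^sub>n(x) = n! [t\<^sup>n] exp (x g)\<close>, and the
  identity is the coefficient form of \<open>exp ((x + y) g) = exp (x g) exp (y g)\<close>.
\<close>

text \<open>Strong induction on \<open>n\<close>: once all lower coefficients vanish, dividing by
  \<open>t ^ n\<close> for \<open>t\<close> nonzero leaves a series with constant term
  \<open>a n\<close> and sum 0. Letting \<open>t\<close> tend to 0 forces
  \<open>a n = 0\<close>.\<close>

lemma powser_eventually_zero_imp_coeff_zero: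
  fixes a :: "nat \<Rightarrow> 'a::{real_normed_field, banach}"
  assumes "\<forall>\<^sub>F t in nhds 0. (\<lambda>n. a n * t ^ n) sums 0"
  shows "a n = 0"
proof (induction n rule: less_induct)
  case (less n)
  obtain s where s: "s > 0" "\<And>t. norm t < s \<Longrightarrow> (\<lambda>n. a n * t ^ n) sums 0"
    using assms by (auto simp: eventually_nhds_metric)
  have "((\<lambda>_. 0) \<longlongrightarrow> a (0 + n)) (at (0::'a))"
  proof (rule powser_limit_0_strong[OF s(1)])
    fix t :: 'a
    assume t: "t \<noteq> 0" "norm t < s"
    have "(\<lambda>i. a (i + n) * t ^ (i + n)) sums 0"
      using s(2)[OF t(2)] less by (subst sums_zero_iff_shift) auto
    then have "(\<lambda>i. a (i + n) * t ^ (i + n) / t ^ n) sums (0 / t ^ n)"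
      by (rule sums_divide)
    then show "(\<lambda>i. a (i + n) * t ^ i) sums 0"
      using t(1) by (simp add: power_add)
  qed
  then show ?case
    by (simp add: tendsto_const_iff)
qed

lemma powser_coeffs_unique:
  fixes a b :: "nat \<Rightarrow> 'a::{real_normed_field, banach}"
  assumes "\<forall>\<^sub>F t in nhds 0. (\<lambda>n. a n * t ^ n) sums f t"
    and "\<forall>\<^sub>F t in nhds 0. (\<lambda>n. b n * t ^ n) sums f t"
  shows "a = b"
proof
  fix n
  have "\<forall>\<^sub>F t in nhds 0. (\<lambda>n. (a n - b n) * t ^ n) sums 0"
    using assms
  proof eventually_elim
    case (elim t)
    then show ?case
      using sums_diff[OF elim] by (simp add: algebra_simps)
  qed
  then have "a n - b n = 0"
    by (rule powser_eventually_zero_imp_coeff_zero)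
  then show "a n = b n"
    by simp
qed

text \<open>Because the entries below \<open>k\<close> vanish, the shifted series can be read as an
  ordinary power series starting at index 0, the form needed for uniqueness of coefficients and for
  formal power series.\<close>

lemma is_prob_lah_coeffs_iff_sums:
  "is_prob_lah_coeffs M Y k a \<longleftrightarrow>
     (\<forall>n<k. a n = 0) \<and>
     (\<forall>\<^sub>F t in nhds 0. (\<lambda>n. a n / fact n * t ^ n) sums
        (1 / fact k * (integral\<^sup>L M (\<lambda>\<omega>. (1 / (1 - t)) powr Y \<omega>) - 1) ^ k))"
proof -
  have "(\<lambda>j. a (k + j) * t ^ (k + j) / fact (k + j)) sums s \<longleftrightarrow>
      (\<lambda>n. a n / fact n * t ^ n) sums s"
    if "\<forall>n<k. a n = 0" for t s :: real
    using that sums_zero_iff_shift[of k "\<lambda>n. a n / fact n * t ^ n" s] by (simp add: add.commute)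
  then show ?thesis
    unfolding is_prob_lah_coeffs_def by (auto cong: conj_cong)
qed

text \<open>This makes the definite description in \<open>prob_lah\<close> meaningful: exhibiting
  one coefficient sequence suffices to evaluate it.\<close>

lemma is_prob_lah_coeffs_unique:
  assumes "is_prob_lah_coeffs M Y k a" "is_prob_lah_coeffs M Y k b"
  shows "a = b"
proof -
  have "(\<lambda>n. a n / fact n) = (\<lambda>n. b n / fact n)"
    using assms unfolding is_prob_lah_coeffs_iff_sums
    by (elim conjE) (rule powser_coeffs_unique)
  then show ?thesis
    by (simp add: fun_eq_iff)
qed

lemma has_fps_expansion_power:
  fixes F :: "'a::{banach, real_normed_div_algebra, comm_ring_1} fps"
  assumes "f has_fps_expansion F"
  shows "(\<lambda>x. f x ^ k) has_fps_expansion F ^ k"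
  using assms by (induction k) (auto intro!: has_fps_expansion_mult)

lemma has_fps_expansion_eventually_sums:
  fixes F :: "'a::{banach, real_normed_div_algebra} fps"
  assumes "f has_fps_expansion F"
  shows "\<forall>\<^sub>F z in nhds 0. (\<lambda>n. fps_nth F n * z ^ n) sums f z"
proof -
  have "\<forall>\<^sub>F z in nhds 0. z \<in> eball 0 (fps_conv_radius F)"
    using assms by (intro eventually_nhds_in_open) (auto simp: has_fps_expansion_def zero_ereal_def)
  moreover have "\<forall>\<^sub>F z in nhds 0. eval_fps F z = f z"
    using assms by (simp add: has_fps_expansion_def)
  ultimately show ?thesis
    by eventually_elim (auto simp: eball_def dest: sums_eval_fps)
qed

lemma prob_lah_eq_fps_nth:
  assumes "(\<lambda>t. integral\<^sup>L M (\<lambda>\<omega>. (1 / (1 - t)) powr Y \<omega>) - 1) has_fps_expansion g"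
    and "fps_nth g 0 = 0"
  shows "prob_lah M Y n k = fact n / fact k * fps_nth (g ^ k) n"
proof -
  define a where "a n = fact n / fact k * fps_nth (g ^ k) n" for n
  have "\<forall>\<^sub>F t in nhds 0. (\<lambda>n. fps_nth (fps_const (1 / fact k) * g ^ k) n * t ^ n) sums
        (1 / fact k * (integral\<^sup>L M (\<lambda>\<omega>. (1 / (1 - t)) powr Y \<omega>) - 1) ^ k)"
    by (intro has_fps_expansion_eventually_sums has_fps_expansion_cmult_left
        has_fps_expansion_power assms)
  \<comment> \<open>Since \<open>g\<close> has no constant term, \<open>g ^ k\<close> has no terms
    of degree below \<open>k\<close>, in agreement with the convention for
    \<open>n < k\<close>.\<close>
  moreover have "\<forall>n<k. a n = 0"
    using startsby_zero_power_prefix[OF assms(2)] by (simp add: a_def)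
  ultimately have "is_prob_lah_coeffs M Y k a"
    by (simp add: is_prob_lah_coeffs_iff_sums a_def)
  then have "(THE a. is_prob_lah_coeffs M Y k a) = a"
    by (blast intro: is_prob_lah_coeffs_unique)
  then show ?thesis
    by (simp add: prob_lah_def a_def)
qed

text \<open>Coefficient \<open>n\<close> of the composition is the finite sum of
  \<open>x ^ k / fact k\<close> times coefficient \<open>n\<close> of \<open>g ^ k\<close> over
  \<open>k\<close> \<le> \<open>n\<close>, which matches the Bell sum term by term.\<close>

lemma prob_lah_bell_eq_fps_nth:
  assumes "(\<lambda>t. integral\<^sup>L M (\<lambda>\<omega>. (1 / (1 - t)) powr Y \<omega>) - 1) has_fps_expansion g"
    and "fps_nth g 0 = 0"
  shows "prob_lah_bell M Y n x = fact n * fps_nth (fps_exp x oo g) n"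
  by (simp add: prob_lah_bell_def prob_lah_eq_fps_nth[OF assms] fps_compose_nth
      sum_distrib_left mult_ac)

text \<open>This is the binomial series with exponent \<open>-a\<close> at \<open>-t\<close>; the
  sign in \<open>-a gchoose n\<close> cancels the one in \<open>(-t) ^ n\<close>.\<close>

lemma pochhammer_powser_sums:
  fixes a t :: real
  assumes "\<bar>t\<bar> < 1"
  shows "(\<lambda>n. pochhammer a n / fact n * t ^ n) sums (1 / (1 - t)) powr a"
proof -
  have "(\<lambda>n. (-a gchoose n) * (-t) ^ n) sums (1 + -t) powr (-a)"
    using assms by (intro gen_binomial_real) simp
  moreover have "(-a gchoose n) * (-t) ^ n = pochhammer a n / fact n * t ^ n" for n
  proof -
    have "(-1) ^ n * (-t) ^ n = t ^ n"
      by (simp flip: power_mult_distrib)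
    then show ?thesis
      by (simp add: gbinomial_pochhammer)
  qed
  moreover have "(1 + -t) powr (-a) = (1 / (1 - t)) powr a"
    using assms by (simp add: powr_minus powr_divide field_simps)
  ultimately show ?thesis
    by simp
qed

lemma abs_pochhammer_le:
  fixes a :: "'a::linordered_idom"
  shows "\<bar>pochhammer a n\<bar> \<le> pochhammer \<bar>a\<bar> n"
  by (auto simp: pochhammer_prod abs_prod intro!: prod_mono order.trans[OF abs_triangle_ineq])

lemma expectation_powr_sums:
  fixes Y :: "'a \<Rightarrow> real"
  assumes Y: "Y \<in> borel_measurable M"
    and mgf: "\<And>t::real. \<bar>t\<bar> < r \<Longrightarrow> integrable M (\<lambda>\<omega>. exp (t * Y \<omega>))"
    and t: "\<bar>t\<bar> < 1 - exp (-r)"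
  shows "(\<lambda>n. integral\<^sup>L M (\<lambda>\<omega>. pochhammer (Y \<omega>) n / fact n) * t ^ n) sums
    integral\<^sup>L M (\<lambda>\<omega>. (1 / (1 - t)) powr Y \<omega>)"
proof -
  note [measurable] = Y
  define f where "f n \<omega> = pochhammer (Y \<omega>) n / fact n * t ^ n" for n \<omega>
  define W where "W \<omega> = (1 / (1 - \<bar>t\<bar>)) powr \<bar>Y \<omega>\<bar>" for \<omega>
  \<comment> \<open>Chosen so that \<open>W\<close> equals
    \<open>exp (s * \<bar>Y \<omega>\<bar>)\<close>. The bound \<open>1 - exp (-r)\<close> on
    \<open>\<bar>t\<bar>\<close> is exactly what puts \<open>s\<close> inside the interval where the
    moment generating function exists.\<close>
  define s where "s = - ln (1 - \<bar>t\<bar>)"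
  have t1: "\<bar>t\<bar> < 1"
    using t by (smt (verit) exp_gt_zero)
  have [measurable]: "f n \<in> borel_measurable M" for n
    unfolding f_def pochhammer_prod by measurable
  have "s \<ge> 0"
    using t1 by (simp add: s_def)
  moreover have "- r < ln (1 - \<bar>t\<bar>)"
    using t t1 by (subst exp_less_cancel_iff[symmetric]) auto
  ultimately have s: "\<bar>s\<bar> < r"
    by (simp add: s_def)
  have int_W: "integrable M W"
  proof (rule Bochner_Integration.integrable_bound)
    show "integrable M (\<lambda>\<omega>. exp (s * Y \<omega>) + exp (- s * Y \<omega>))"
      using mgf[of s] mgf[of "-s"] s by auto
    show "W \<in> borel_measurable M"
      unfolding W_def by measurable
    have "W \<omega> = exp (s * \<bar>Y \<omega>\<bar>)" for \<omega>
      using t1 by (simp add: W_def s_def powr_def ln_div)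
    \<comment> \<open>Whatever the sign of \<open>Y \<omega>\<close>, one of the two summands equals
      \<open>W \<omega>\<close> and the other is positive.\<close>
    then have "W \<omega> \<le> exp (s * Y \<omega>) + exp (- s * Y \<omega>)" for \<omega>
      by (cases "Y \<omega> \<ge> 0") auto
    moreover have "W \<omega> \<ge> 0" for \<omega>
      by (simp add: W_def)
    ultimately show "AE \<omega> in M. norm (W \<omega>) \<le> norm (exp (s * Y \<omega>) + exp (- s * Y \<omega>))"
      by (simp add: add_nonneg_nonneg)
  qed
  \<comment> \<open>\<open>W\<close> is the sum of the same series with
    \<open>\<bar>Y \<omega>\<bar>\<close> and \<open>\<bar>t\<bar>\<close>, whose terms are
    nonnegative and dominate. Singletons \<open>I\<close> give integrability of each term, initial
    segments the domination of the partial sums.\<close>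
  have bound: "(\<Sum>i\<in>I. \<bar>f i \<omega>\<bar>) \<le> W \<omega>" if "finite I" for I \<omega>
  proof -
    let ?h = "\<lambda>i. pochhammer \<bar>Y \<omega>\<bar> i / fact i * \<bar>t\<bar> ^ i"
    have h: "?h sums W \<omega>"
      using pochhammer_powser_sums[of "\<bar>t\<bar>" "\<bar>Y \<omega>\<bar>"] t1 by (simp add: W_def)
    have nonneg: "0 \<le> pochhammer \<bar>Y \<omega>\<bar> i" for i
      by (rule order.trans[OF abs_ge_zero abs_pochhammer_le])
    have "\<bar>f i \<omega>\<bar> \<le> ?h i" for i
      unfolding f_def abs_mult abs_divide power_abs
      by (intro mult_mono) (auto simp: abs_pochhammer_le divide_right_mono nonneg)
    then have "(\<Sum>i\<in>I. \<bar>f i \<omega>\<bar>) \<le> (\<Sum>i\<in>I. ?h i)"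
      by (rule sum_mono)
    also have "\<dots> \<le> W \<omega>"
      using h sum_le_suminf[of ?h I] that
      by (simp add: sums_iff nonneg)
    finally show ?thesis .
  qed
  have int_f: "integrable M (f n)" for n
    using bound[of "{n}"]
    by (intro Bochner_Integration.integrable_bound[OF int_W]) (auto simp: W_def)
  have "(\<lambda>n. \<integral>\<omega>. (\<Sum>i<n. f i \<omega>) \<partial>M) \<longlonglongrightarrow> (\<integral>\<omega>. (1 / (1 - t)) powr Y \<omega> \<partial>M)"
  proof (rule integral_dominated_convergence)
    show "AE \<omega> in M. (\<lambda>n. \<Sum>i<n. f i \<omega>) \<longlonglongrightarrow> (1 / (1 - t)) powr Y \<omega>"
      using pochhammer_powser_sums[OF t1] by (simp add: f_def sums_def)
    show "AE \<omega> in M. norm (\<Sum>i<n. f i \<omega>) \<le> W \<omega>" for n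
      using bound[of "{..<n}"] by (auto intro: order.trans[OF sum_abs])
  qed (use int_W in measurable)
  also have "(\<lambda>n. \<integral>\<omega>. (\<Sum>i<n. f i \<omega>) \<partial>M) =
      (\<lambda>n. \<Sum>i<n. integral\<^sup>L M (\<lambda>\<omega>. pochhammer (Y \<omega>) i / fact i) * t ^ i)"
    by (subst Bochner_Integration.integral_sum[OF int_f]) (simp only: f_def[abs_def] integral_mult_left_zero)
  finally show ?thesis
    by (simp add: sums_def)
qed

theorem theorem2p7:
  fixes M :: "'a measure" and Y :: "'a \<Rightarrow> real" and r :: real and n :: nat and x y :: real
  assumes "prob_space M"
    and "Y \<in> borel_measurable M"
    and "r > 0"
    and "\<And>t::real. \<bar>t\<bar> < r \<Longrightarrow> integrable M (\<lambda>\<omega>. exp (t * Y \<omega>))"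
  shows "prob_lah_bell M Y n (x + y) =
    (\<Sum>k=0..n. real (n choose k) * prob_lah_bell M Y k x * prob_lah_bell M Y (n - k) y)"
proof -
  interpret prob_space M by fact
  define F where "F = Abs_fps (\<lambda>n. integral\<^sup>L M (\<lambda>\<omega>. pochhammer (Y \<omega>) n / fact n))"
  define g where "g = F - 1"
  have "\<forall>\<^sub>F t in nhds (0::real). t \<in> ball 0 (1 - exp (-r))"
    using assms(3) by (intro eventually_nhds_in_open) auto
  then have "(\<lambda>t. integral\<^sup>L M (\<lambda>\<omega>. (1 / (1 - t)) powr Y \<omega>)) has_fps_expansion F"
    by (intro has_fps_expansionI, elim eventually_mono)
      (use expectation_powr_sums[OF assms(2,4)] in \<open>auto simp: F_def\<close>)
  then have g: "(\<lambda>t. integral\<^sup>L M (\<lambda>\<omega>. (1 / (1 - t)) powr Y \<omega>) - 1) has_fps_expansion g"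
    unfolding g_def by (intro has_fps_expansion_diff has_fps_expansion_1)
  \<comment> \<open>The constant term of \<open>F\<close> is the expectation of 1, which is 1
    because \<open>M\<close> has total mass 1. This also makes composition with \<open>g\<close>
    multiplicative below.\<close>
  have g0: "fps_nth g 0 = 0"
    by (simp add: g_def F_def prob_space)
  note bell = prob_lah_bell_eq_fps_nth[OF g g0]
  have "fps_exp (x + y) oo g = (fps_exp x oo g) * (fps_exp y oo g)"
    by (simp add: fps_exp_add_mult fps_compose_mult_distrib[OF g0])
  then have "prob_lah_bell M Y n (x + y) =
      (\<Sum>k=0..n. fact n * (fps_nth (fps_exp x oo g) k * fps_nth (fps_exp y oo g) (n - k)))"
    by (simp add: bell fps_mult_nth sum_distrib_left)
  \<comment> \<open>Writing \<open>fact n\<close> as \<open>n choose k\<close> times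
    \<open>fact k * fact (n - k)\<close> gives each coefficient the factorial that turns it into a
    Bell polynomial value.\<close>
  also have "\<dots> =
      (\<Sum>k=0..n. real (n choose k) * prob_lah_bell M Y k x * prob_lah_bell M Y (n - k) y)"
    by (intro sum.cong) (auto simp: bell binomial_fact)
  finally show ?thesis .
qed

end
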